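(* Let $C_0[0,\infty)$ be the (real or complex) Banach space of (real- or complex-valued) functions continuous on $[0,\infty)$ and vanishing at infinity, with the norm $\|x\|_\infty:=\sup_{t\ge 0}|x(t)|$. Let $w>1$ and $a>0$ be real numbers. Then the weighted left translation $$(T_{w,a}x)(t):=w^{t}x(t+a),\quad t\ge 0,$$ with domain $$D(T_{w,a}):=\left\{x\in C_0[0,\infty) : \lim_{t\to\infty} w^{t}x(t+a)=0\right\}$$ is a chaotic unbounded linear operator in $C_0[0,\infty)$. Furthermore, if the underlying space is complex, then $$\sigma(T_{w,a})=\sigma_p(T_{w,a})=\mathbb{C}.$$
   Context: Let $T$ be a (bounded or unbounded) linear operator in a (real or complex) Banach space $X$ with domain $D(T)$. Powers have their natural domains: $T^0:=I$ is the identity operator and $D(T^{n})=\{x\in D(T^{n-1}) : T^{n-1}x\in D(T)\}$; $C^\infty(T):=\bigcap_{n=0}^\infty D(T^n)$. A nonzero vector $x\in C^\infty(T)$ is hypercyclic for $T$ if its orbit $\{T^nx : n=0,1,2,\dots\}$ is dense in $X$; $T$ is hypercyclic if it has a hypercyclic vector. A vector $x$ is a periodic point of $T$ if there is $N\in\mathbb{N}=\{1,2,\dots\}$ with $x\in D(T^N)$ and $T^Nx=x$. $T$ is chaotic if it is hypercyclic and its set of periodic points is dense in $X$. For a linear operator $T$ in a complex Banach space $X$: the resolvent set $\rho(T)$ is the set of $\lambda\in\mathbb{C}$ such that $T-\lambda I$ has an inverse that is a bounded linear operator defined on all of $X$; the spectrum is $\sigma(T):=\mathbb{C}\setminus\rho(T)$;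 the point spectrum $\sigma_p(T)$ is the set of eigenvalues of $T$ (those $\lambda$ for which $T-\lambda I$ is not injective on $D(T)$). *)

theory Defs
  imports "HOL-Analysis.Analysis"
begin

section \<open>Linear operators with domain in a Banach space\<close>

text \<open>
  An operator is a pair of its domain and a total function, whose values outside the domain are
  irrelevant. HOL-Analysis only has real Banach spaces as a type class, so the scalar
  multiplication is an explicit parameter wherever the scalar field matters.
\<close>

type_synonym 'x operator = "'x set \<times> ('x \<Rightarrow> 'x)"

definition linear_operator :: "('k::field \<Rightarrow> 'x::banach \<Rightarrow> 'x) \<Rightarrow> 'x operator \<Rightarrow> bool" where
  "linear_operator scl T \<longleftrightarrow>
     module.subspace scl (fst T) \<and>
     (\<forall>x\<in>fst T. \<forall>y\<in>fst T. snd T (x + y) = snd T x + snd T y) \<and>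
     (\<forall>c. \<forall>x\<in>fst T. snd T (scl c x) = scl c (snd T x))"

definition bounded_operator :: "'x::banach operator \<Rightarrow> bool" where
  "bounded_operator T \<longleftrightarrow> (\<exists>K. \<forall>x\<in>fst T. norm (snd T x) \<le> K * norm x)"

fun power_domain :: "'x operator \<Rightarrow> nat \<Rightarrow> 'x set" where
  "power_domain T 0 = UNIV"
| "power_domain T (Suc n) = {x \<in> power_domain T n. (snd T ^^ n) x \<in> fst T}"

definition C_infinity :: "'x operator \<Rightarrow> 'x set" where
  "C_infinity T = (\<Inter>n. power_domain T n)"

definition hypercyclic_vector :: "'x::banach operator \<Rightarrow> 'x \<Rightarrow> bool" where
  "hypercyclic_vector T x \<longleftrightarrow>
     x \<noteq> 0 \<and> x \<in> C_infinity T \<and> closure (range (\<lambda>n. (snd T ^^ n) x)) = UNIV"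

definition hypercyclic :: "'x::banach operator \<Rightarrow> bool" where
  "hypercyclic T \<longleftrightarrow> (\<exists>x. hypercyclic_vector T x)"

definition periodic_point :: "'x operator \<Rightarrow> 'x \<Rightarrow> bool" where
  "periodic_point T x \<longleftrightarrow> (\<exists>N\<ge>1. x \<in> power_domain T N \<and> (snd T ^^ N) x = x)"

definition chaotic :: "'x::banach operator \<Rightarrow> bool" where
  "chaotic T \<longleftrightarrow> hypercyclic T \<and> closure {x. periodic_point T x} = UNIV"

definition resolvent_set :: "('k::field \<Rightarrow> 'x::banach \<Rightarrow> 'x) \<Rightarrow> 'x operator \<Rightarrow> 'k set" where
  "resolvent_set scl T =
     {l. \<exists>R. linear_operator scl (UNIV, R) \<and> bounded_operator (UNIV, R) \<and>
             (\<forall>y. R y \<in> fst T \<and> snd T (R y) - scl l (R y) = y) \<and>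
             (\<forall>x\<in>fst T. R (snd T x - scl l x) = x)}"

definition spectrum :: "('k::field \<Rightarrow> 'x::banach \<Rightarrow> 'x) \<Rightarrow> 'x operator \<Rightarrow> 'k set" where
  "spectrum scl T = - resolvent_set scl T"

definition point_spectrum :: "('k::field \<Rightarrow> 'x::banach \<Rightarrow> 'x) \<Rightarrow> 'x operator \<Rightarrow> 'k set" where
  "point_spectrum scl T = {l. \<not> inj_on (\<lambda>x. snd T x - scl l x) (fst T)}"


section \<open>The Banach space of continuous functions on the half-line vanishing at infinity\<close>

text \<open>
  A function on the half-line is represented by its extension by 0 to the negative reals, so that
  equality in the type is equality on the half-line; only the restriction is continuous.
\<close>

typedef (overloaded) 'k c0 =
  "{f :: real \<Rightarrow> 'k::real_normed_vector.
      continuous_on {0..} f \<and> (f \<longlongrightarrow> 0) at_top \<and> (\<forall>t<0. f t = 0)}"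
  morphisms c0_apply Abs_c0
  by (rule exI[of _ "\<lambda>_. 0"]) auto

setup_lifting type_definition_c0

lemma c0_eqI: "x = y" if "\<And>t. 0 \<le> t \<Longrightarrow> c0_apply x t = c0_apply y t"
proof -
  have "c0_apply x t = c0_apply y t" for t
    using that[of t] c0_apply[of x] c0_apply[of y] by (cases "0 \<le> t") auto
  then show ?thesis
    by (simp add: c0_apply_inject[symmetric] fun_eq_iff)
qed

instantiation c0 :: (real_normed_vector) real_vector
begin

lift_definition zero_c0 :: "'a c0" is "\<lambda>_. 0" by auto

lift_definition plus_c0 :: "'a c0 \<Rightarrow> 'a c0 \<Rightarrow> 'a c0" is "\<lambda>f g t. f t + g t"
  by (auto intro!: continuous_intros tendsto_add_zero)

lift_definition uminus_c0 :: "'a c0 \<Rightarrow> 'a c0" is "\<lambda>f t. - f t"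
  by (auto intro!: continuous_intros simp: tendsto_minus_cancel_left[symmetric])

lift_definition minus_c0 :: "'a c0 \<Rightarrow> 'a c0 \<Rightarrow> 'a c0" is "\<lambda>f g t. f t - g t"
  by (auto intro!: continuous_intros tendsto_diff[where a = 0 and b = 0, simplified])

lift_definition scaleR_c0 :: "real \<Rightarrow> 'a c0 \<Rightarrow> 'a c0" is "\<lambda>r f t. r *\<^sub>R f t"
  by (auto intro!: continuous_intros tendsto_scaleR[OF tendsto_const, where b = 0, simplified])

instance
  by standard (transfer; auto simp: algebra_simps)+

end

lemma c0_apply_simps [simp]:
  "c0_apply 0 t = 0"
  "c0_apply (x + y) t = c0_apply x t + c0_apply y t"
  "c0_apply (- x) t = - c0_apply x t"
  "c0_apply (x - y) t = c0_apply x t - c0_apply y t"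
  "c0_apply (r *\<^sub>R x) t = r *\<^sub>R c0_apply x t"
  by (transfer; simp)+

lemma c0_bdd: "bdd_above ((\<lambda>t. norm (c0_apply x t)) ` {0..})"
proof -
  let ?f = "c0_apply x"
  have cont: "continuous_on {0..} ?f" and lim: "(?f \<longlongrightarrow> 0) at_top"
    using c0_apply[of x] by auto
  obtain b where b: "\<And>t. t \<ge> b \<Longrightarrow> norm (?f t) < 1"
    using tendstoD[OF lim, of 1] by (auto simp: eventually_at_top_linorder)
  have "compact ((\<lambda>t. norm (?f t)) ` {0..b})"
    by (intro compact_continuous_image continuous_on_norm)
       (auto intro: continuous_on_subset[OF cont])
  then have "bdd_above ((\<lambda>t. norm (?f t)) ` {0..b})"
    by (intro bounded_imp_bdd_above compact_imp_bounded)
  then obtain K where K: "\<And>t. t \<in> {0..b} \<Longrightarrow> norm (?f t) \<le> K"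
    unfolding bdd_above_def by blast
  have "norm (?f t) \<le> max K 1" if "t \<ge> 0" for t
    using less_imp_le[OF b[of t]] K[of t] that by (cases "t \<le> b") (auto simp: le_max_iff_disj)
  then show ?thesis by (auto intro!: bdd_aboveI[of _ "max K 1"])
qed

instantiation c0 :: (real_normed_vector) real_normed_vector
begin

definition norm_c0 :: "'a c0 \<Rightarrow> real" where
  "norm_c0 x = (SUP t\<in>{0..}. norm (c0_apply x t))"

definition dist_c0 :: "'a c0 \<Rightarrow> 'a c0 \<Rightarrow> real" where
  "dist_c0 x y = norm (x - y)"

definition sgn_c0 :: "'a c0 \<Rightarrow> 'a c0" where
  "sgn_c0 x = x /\<^sub>R norm x"

definition uniformity_c0 :: "('a c0 \<times> 'a c0) filter" where
  "uniformity_c0 = (INF e\<in>{0 <..}. principal {(x, y). dist x y < e})"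

definition open_c0 :: "'a c0 set \<Rightarrow> bool" where
  "open_c0 U \<longleftrightarrow> (\<forall>x\<in>U. \<forall>\<^sub>F (x', y) in uniformity. x' = x \<longrightarrow> y \<in> U)"

lemma c0_norm_upper: "norm (c0_apply x t) \<le> norm x"
proof -
  have "norm (c0_apply x t) \<le> (SUP s\<in>{0..}. norm (c0_apply x s))" if "t \<ge> 0" for t
    using that by (intro cSUP_upper c0_bdd) auto
  from this[of t] order_trans[OF norm_ge_zero this[of 0]] show ?thesis
    using c0_apply[of x] by (cases "t \<ge> 0") (auto simp: norm_c0_def)
qed

lemma c0_norm_least: "norm x \<le> b" if "\<And>t. t \<ge> 0 \<Longrightarrow> norm (c0_apply x t) \<le> b"
  unfolding norm_c0_def using that by (intro cSUP_least) auto

lemma c0_norm_scale_le: "norm (r *\<^sub>R x) \<le> \<bar>r\<bar> * norm x" for x :: "'a c0"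
  by (intro c0_norm_least) (simp add: mult_left_mono c0_norm_upper)

instance
proof
  fix x y :: "'a c0" and r :: real
  show "norm x = 0 \<longleftrightarrow> x = 0"
  proof
    assume "norm x = 0"
    with c0_norm_upper[of x] show "x = 0" by (intro c0_eqI) simp
  next
    assume "x = 0"
    then show "norm x = 0" by (simp add: norm_c0_def)
  qed
  show "norm (x + y) \<le> norm x + norm y"
    by (intro c0_norm_least) (simp add: norm_triangle_le add_mono c0_norm_upper)
  show "norm (r *\<^sub>R x) = \<bar>r\<bar> * norm x"
  proof (cases "r = 0")
    case True
    then show ?thesis by (simp add: norm_c0_def)
  next
    case False
    have "\<bar>r\<bar> * norm x = \<bar>r\<bar> * norm ((1 / r) *\<^sub>R (r *\<^sub>R x))" using False by simp
    also have "\<dots> \<le> \<bar>r\<bar> * (\<bar>1 / r\<bar> * norm (r *\<^sub>R x))"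
      by (intro mult_left_mono c0_norm_scale_le) auto
    also have "\<dots> = norm (r *\<^sub>R x)" using False by simp
    finally show ?thesis using c0_norm_scale_le[of r x] by linarith
  qed
qed (rule dist_c0_def sgn_c0_def uniformity_c0_def open_c0_def)+

end

instance c0 :: (banach) banach
proof
  fix X :: "nat \<Rightarrow> 'a c0"
  assume X: "Cauchy X"
  let ?F = "\<lambda>n. c0_apply (X n)"
  have "uniformly_Cauchy_on UNIV ?F"
    unfolding uniformly_Cauchy_on_def
  proof safe
    fix e :: real assume "e > 0"
    then obtain M where M: "\<And>m n. m \<ge> M \<Longrightarrow> n \<ge> M \<Longrightarrow> dist (X m) (X n) < e"
      using X unfolding Cauchy_def by metis
    have "dist (?F m t) (?F n t) < e" if "m \<ge> M" "n \<ge> M" for m n t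
      using M[OF that] c0_norm_upper[of "X m - X n" t] by (simp add: dist_norm)
    then show "\<exists>M. \<forall>x\<in>UNIV. \<forall>m\<ge>M. \<forall>n\<ge>M. dist (?F m x) (?F n x) < e" by blast
  qed
  then obtain f where f: "uniform_limit UNIV ?F f sequentially"
    using Cauchy_uniformly_convergent unfolding uniformly_convergent_on_def by blast
  have cont: "continuous_on {0..} f"
  proof (rule uniform_limit_theorem)
    show "uniform_limit {0..} ?F f sequentially" using f by (rule uniform_limit_on_subset) simp
    show "\<forall>\<^sub>F n in sequentially. continuous_on {0..} (?F n)"
      using c0_apply by (intro always_eventually) blast
  qed simp
  have lim: "(f \<longlongrightarrow> 0) at_top"
  proof (rule tendstoI)
    fix e :: real assume "e > 0"
    then obtain n where n: "\<And>t. dist (?F n t) (f t) < e / 2"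
      using uniform_limitD[OF f, of "e / 2"] by (auto simp: eventually_sequentially)
    have "(?F n \<longlongrightarrow> 0) at_top" using c0_apply by blast
    then have "\<forall>\<^sub>F t in at_top. dist (?F n t) 0 < e / 2"
      using \<open>e > 0\<close> by (intro tendstoD) auto
    then show "\<forall>\<^sub>F t in at_top. dist (f t) 0 < e"
    proof eventually_elim
      case (elim t)
      then show ?case using n[of t] dist_triangle[of "f t" 0 "?F n t"]
        by (simp add: dist_commute)
    qed
  qed
  have neg: "f t = 0" if "t < 0" for t
  proof -
    have "(\<lambda>n. ?F n t) \<longlonglongrightarrow> f t" using f by (rule tendsto_uniform_limitI) simp
    moreover have "?F n t = 0" for n using c0_apply[of "X n"] that by auto
    ultimately show ?thesis by (simp add: LIMSEQ_const_iff)
  qed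
  have app: "c0_apply (Abs_c0 f) = f"
    using cont lim neg by (intro Abs_c0_inverse) auto
  have "X \<longlonglongrightarrow> Abs_c0 f"
  proof (rule tendstoI)
    fix e :: real assume "e > 0"
    then have "\<forall>\<^sub>F n in sequentially. \<forall>t\<in>UNIV. dist (?F n t) (f t) < e / 2"
      by (intro uniform_limitD[OF f]) simp
    then show "\<forall>\<^sub>F n in sequentially. dist (X n) (Abs_c0 f) < e"
    proof eventually_elim
      case (elim n)
      have "norm (X n - Abs_c0 f) \<le> e / 2"
        using elim by (intro c0_norm_least) (auto simp: app dist_norm less_imp_le)
      then show ?case using \<open>e > 0\<close> by (simp add: dist_norm)
    qed
  qed
  then show "convergent X" by (rule convergentI)
qed

text \<open>Multiplication by scalars from the field of values, which may be complex.\<close>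

lift_definition scale_c0 :: "'k::real_normed_field \<Rightarrow> 'k c0 \<Rightarrow> 'k c0" is "\<lambda>c f t. c * f t"
  by (auto intro!: continuous_intros tendsto_mult_right_zero)

lemma scale_c0_apply [simp]: "c0_apply (scale_c0 c x) t = c * c0_apply x t"
  by transfer simp

lemma vector_space_scale_c0: "vector_space scale_c0"
  by unfold_locales (auto intro!: c0_eqI simp: algebra_simps)

lemma norm_scale_c0: "norm (scale_c0 c x) = norm c * norm x"
proof -
  have "scale_c0 c x = 0 \<and> norm c = 0 \<or> c \<noteq> 0" by (auto intro: c0_eqI)
  moreover have le: "norm (scale_c0 c x) \<le> norm c * norm x" for c and x :: "'a c0"
    by (intro c0_norm_least) (simp add: norm_mult mult_left_mono c0_norm_upper)
  moreover have "norm c * norm x \<le> norm (scale_c0 c x)" if "c \<noteq> 0"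
  proof -
    have "scale_c0 (inverse c) (scale_c0 c x) = x"
      using that by (intro c0_eqI) (simp add: field_simps)
    with le[of "inverse c" "scale_c0 c x"] that show ?thesis
      by (simp add: norm_divide norm_inverse field_simps)
  qed
  ultimately show ?thesis by (metis antisym mult_zero_left norm_zero)
qed


section \<open>The weighted left translation\<close>

text \<open>
  On the domain the function passed to \<^term>\<open>Abs_c0\<close> is a genuine element of the space, see
  the lemma below.
\<close>

definition translation :: "real \<Rightarrow> real \<Rightarrow> 'k::real_normed_vector c0 operator" where
  "translation w a =
     ({x. ((\<lambda>t. (w powr t) *\<^sub>R c0_apply x (t + a)) \<longlongrightarrow> 0) at_top},
      \<lambda>x. Abs_c0 (\<lambda>t. if t < 0 then 0 else (w powr t) *\<^sub>R c0_apply x (t + a)))"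

lemma translation_apply:
  assumes "w > 0" "a \<ge> 0" "x \<in> fst (translation w a)" "t \<ge> 0"
  shows "c0_apply (snd (translation w a) x) t = (w powr t) *\<^sub>R c0_apply x (t + a)"
proof -
  let ?g = "\<lambda>t. (w powr t) *\<^sub>R c0_apply x (t + a)"
  let ?f = "\<lambda>t. if t < 0 then 0 else ?g t"
  have "continuous_on {0..} (c0_apply x)" using c0_apply[of x] by auto
  then have "continuous_on {0..} (\<lambda>t. c0_apply x (t + a))"
    by (rule continuous_on_compose2) (use assms in \<open>auto intro!: continuous_intros\<close>)
  then have "continuous_on {0..} ?g"
    using assms by (intro continuous_intros) auto
  then have "continuous_on {0..} ?f"
    by (rule continuous_on_eq) auto
  moreover have "(?f \<longlongrightarrow> 0) at_top"
  proof (rule Lim_transform_eventually)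
    show "(?g \<longlongrightarrow> 0) at_top" using assms by (simp add: translation_def)
    show "\<forall>\<^sub>F t in at_top. ?g t = ?f t"
      using eventually_ge_at_top[of 0] by eventually_elim auto
  qed
  ultimately show ?thesis
    using assms by (simp add: translation_def Abs_c0_inverse)
qed

end

theory Submission
  imports Defs
begin

text \<open>
  The translation \<open>T\<close> has a right inverse \<open>S\<close> that is defined on the whole space: shift \<open>x\<close> to
  the right by \<open>a\<close>, divide by the weight, and fill the gap \<open>[0, a]\<close> with the linear ramp from
  \<open>0\<close> up to \<open>x 0\<close>. Since the ramp starts at \<open>0\<close>, each further application of \<open>S\<close> makes the
  function vanish on one more interval of length \<open>a\<close>, and dividing by the growing weight
  \<open>w powr t\<close> then gains an ever better constant. Hence the norms of \<open>S ^^ m x\<close> decay faster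
  than every geometric sequence (\<open>summable_ramp_inverse_powers\<close>). In the other direction,
  iterating \<open>T\<close> moves a function of bounded support off the half-line after finitely many
  steps, and these functions are dense.

  Everything follows from these two facts, because \<open>T\<close> is closed and can therefore be applied
  term by term to a series as soon as both the series and the series of images converge. If
  \<open>T ^^ d y = 0\<close>, the series of \<open>S ^^ (k * N) y\<close> is a fixed vector of \<open>T ^^ N\<close> for each
  positive \<open>N \<ge> d\<close>, and for large \<open>N\<close> it is close to its first term \<open>y\<close>: periodic points are
  dense. If a sequence \<open>y\<close> visits each member of a countable dense set infinitely often and
  \<open>N\<close> grows fast enough, then the orbit of the sum of \<open>S ^^ N k (y k)\<close> is close to \<open>y j\<close> at
  time \<open>N j\<close>, because the terms before \<open>j\<close> have already been annihilated and those after \<open>j\<close>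
  are still small: this sum is a hypercyclic vector. Both arguments use only a closed operator
  with such a right inverse, and \<open>chaotic_if_nilpotent_dense\<close> states them in that generality.

  If \<open>u\<close> is in the kernel of \<open>T\<close>, the series of \<open>l ^ k\<close> times \<open>S ^^ k u\<close> satisfies
  \<open>T x = l x\<close>. It converges for every scalar \<open>l\<close> because of the superexponential decay. So
  every scalar is an eigenvalue, and every eigenvalue lies in the spectrum. Unboundedness is
  seen on bumps moving to the right.
\<close>

section \<open>Chaos for closed operators with a summable right inverse\<close>

lemma power_domain_iff: "x \<in> power_domain T n \<longleftrightarrow> (\<forall>m<n. (snd T ^^ m) x \<in> fst T)"
  by (induction n) (auto simp: less_Suc_eq)

lemma C_infinity_iff: "x \<in> C_infinity T \<longleftrightarrow> (\<forall>n. (snd T ^^ n) x \<in> fst T)"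
  unfolding C_infinity_def by (auto simp: power_domain_iff)

definition operator_graph :: "'x operator \<Rightarrow> ('x \<times> 'x) set" where
  "operator_graph T = (\<lambda>x. (x, snd T x)) ` fst T"

text \<open>
  Linearity is taken over the reals so that one criterion covers both scalar fields.
  Hypercyclic vectors and periodic points are sums of series of vectors \<open>(S ^^ m) x\<close>:
  summability makes them converge, and \<open>T (S x) = x\<close> makes their orbits computable.
\<close>

locale summably_right_invertible =
  fixes T :: "'x::banach operator" and S :: "'x \<Rightarrow> 'x"
  assumes linear: "linear_operator (*\<^sub>R) T"
    and closed_graph: "closed (operator_graph T)"
    and S_domain: "S x \<in> fst T"
    and T_S: "snd T (S x) = x"
    and summable_S: "summable (\<lambda>m. norm ((S ^^ m) x))"
begin

lemma domain_subspace: "subspace (fst T)"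
  using linear unfolding linear_operator_def subspace_raw_def by blast

lemma zero_domain: "0 \<in> fst T" and T_zero: "snd T 0 = 0"
proof -
  show z: "0 \<in> fst T" using domain_subspace by (rule subspace_0)
  have "snd T (0 + 0) = snd T 0 + snd T 0"
    using linear z unfolding linear_operator_def by blast
  then show "snd T 0 = 0" by simp
qed

lemma T_iterate_zero: "(snd T ^^ n) 0 = 0"
  by (induction n) (auto simp: T_zero)

lemma T_iterate_zero_mono:
  assumes "(snd T ^^ d) y = 0" "d \<le> n"
  shows "(snd T ^^ n) y = 0"
proof -
  have "(snd T ^^ n) y = (snd T ^^ (n - d)) ((snd T ^^ d) y)"
    using assms(2) by (metis add.commute comp_apply funpow_add le_add_diff_inverse)
  then show ?thesis by (simp add: assms T_iterate_zero)
qed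

lemma T_iterate_S_iterate:
  shows "n \<le> N \<Longrightarrow> (snd T ^^ n) ((S ^^ N) y) = (S ^^ (N - n)) y"
    and "N \<le> n \<Longrightarrow> (snd T ^^ n) ((S ^^ N) y) = (snd T ^^ (n - N)) y"
proof -
  have *: "(snd T ^^ n) ((S ^^ (n + k)) y) = (S ^^ k) y" for n k y
  proof (induction n)
    case (Suc n)
    have "(snd T ^^ Suc n) ((S ^^ (Suc n + k)) y) = (snd T ^^ n) (snd T (S ((S ^^ (n + k)) y)))"
      by (simp add: funpow_swap1)
    then show ?case using Suc by (simp add: T_S)
  qed simp
  show "n \<le> N \<Longrightarrow> (snd T ^^ n) ((S ^^ N) y) = (S ^^ (N - n)) y"
    using *[of n "N - n" y] by simp
  have "(snd T ^^ (k + N)) ((S ^^ N) y) = (snd T ^^ k) y" for k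
    using *[of N 0 y] by (simp add: funpow_add)
  from this[of "n - N"] show "N \<le> n \<Longrightarrow> (snd T ^^ n) ((S ^^ N) y) = (snd T ^^ (n - N)) y"
    by simp
qed

lemma S_iterate_C_infinity:
  assumes "y \<in> C_infinity T"
  shows "(S ^^ N) y \<in> C_infinity T"
  unfolding C_infinity_iff
proof
  fix n
  show "(snd T ^^ n) ((S ^^ N) y) \<in> fst T"
  proof (cases "n < N")
    case True
    then obtain k where "N - n = Suc k" by (metis Suc_diff_Suc)
    with True show ?thesis by (simp add: T_iterate_S_iterate(1) S_domain)
  next
    case False
    then show ?thesis using assms by (simp add: T_iterate_S_iterate(2) C_infinity_iff)
  qed
qed

text \<open>
  The partial sums and their images converge, so the pair of the two limits lies in the closed
  graph.
\<close>

lemma suminf_domain: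
  assumes dom: "\<And>k. f k \<in> fst T" and f: "summable f" and Tf: "summable (\<lambda>k. snd T (f k))"
  shows "suminf f \<in> fst T" and "snd T (suminf f) = (\<Sum>k. snd T (f k))"
proof -
  have part: "(\<Sum>k<n. f k) \<in> fst T \<and> snd T (\<Sum>k<n. f k) = (\<Sum>k<n. snd T (f k))" for n
  proof (induction n)
    case 0
    then show ?case by (simp add: zero_domain T_zero)
  next
    case (Suc n)
    then show ?case
      using linear dom[of n] subspace_add[OF domain_subspace, of "\<Sum>k<n. f k" "f n"]
      unfolding linear_operator_def by auto
  qed
  have "((\<Sum>k<n. f k), (\<Sum>k<n. snd T (f k))) \<in> operator_graph T" for n
    using part[of n] unfolding operator_graph_def by (auto intro: image_eqI)
  moreover have "(\<lambda>n. ((\<Sum>k<n. f k), (\<Sum>k<n. snd T (f k))))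
      \<longlonglongrightarrow> (suminf f, \<Sum>k. snd T (f k))"
    by (intro tendsto_Pair summable_LIMSEQ f Tf)
  ultimately have "(suminf f, \<Sum>k. snd T (f k)) \<in> operator_graph T"
    by (rule closed_sequentially[OF closed_graph])
  then show "suminf f \<in> fst T" "snd T (suminf f) = (\<Sum>k. snd T (f k))"
    unfolding operator_graph_def by auto
qed

text \<open>
  Iterating \<open>suminf_domain\<close> passes through every power of \<open>T\<close>, so convergence is needed for
  every \<open>n\<close>, even if only the orbit at some sparse times is of interest.
\<close>

lemma suminf_C_infinity:
  assumes dom: "\<And>k. f k \<in> C_infinity T" and sm: "\<And>n. summable (\<lambda>k. (snd T ^^ n) (f k))"
  shows "suminf f \<in> C_infinity T" and "(snd T ^^ n) (suminf f) = (\<Sum>k. (snd T ^^ n) (f k))"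
proof -
  have step: "(\<Sum>k. (snd T ^^ n) (f k)) \<in> fst T"
    "snd T (\<Sum>k. (snd T ^^ n) (f k)) = (\<Sum>k. (snd T ^^ Suc n) (f k))" for n
    using suminf_domain[of "\<lambda>k. (snd T ^^ n) (f k)"] dom sm[of n] sm[of "Suc n"]
    by (auto simp: C_infinity_iff)
  have eq: "(snd T ^^ n) (suminf f) = (\<Sum>k. (snd T ^^ n) (f k))" for n
    by (induction n) (use step in auto)
  then show "(snd T ^^ n) (suminf f) = (\<Sum>k. (snd T ^^ n) (f k))" .
  show "suminf f \<in> C_infinity T"
    using eq step by (simp add: C_infinity_iff)
qed

text \<open>
  The point is the series of \<open>(S ^^ (k * N)) y\<close>. Applying \<open>T ^^ N\<close> kills the first term if
  \<open>d \<le> N\<close>, and shifts the others down by one place, which gives the same series again. The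
  distance to \<open>y\<close> is at most a tail of the summable sequence of norms of \<open>(S ^^ m) y\<close>, and it
  is small if \<open>N\<close> is large.
\<close>

lemma periodic_point_near:
  assumes y: "y \<in> C_infinity T" "(snd T ^^ d) y = 0" and "e > 0"
  obtains p where "periodic_point T p" "norm (p - y) < e"
proof -
  obtain N0 where N0: "\<And>n. n \<ge> N0 \<Longrightarrow> norm (\<Sum>i. norm ((S ^^ (i + n)) y)) < e"
    using suminf_exist_split[OF \<open>e > 0\<close> summable_S] by blast
  define N where "N = Suc (max d N0)"
  have N: "N \<ge> 1" "N \<ge> d" "N \<ge> N0" by (auto simp: N_def)
  define f where "f k = (S ^^ (k * N)) y" for k
  define g where "g m = norm ((S ^^ (m + N)) y)" for m
  have g: "summable g"
    unfolding g_def using summable_ignore_initial_segment[OF summable_S] .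
  have inj: "inj (\<lambda>k. k * N)" using N by (auto simp: inj_on_def)
  have tail_f: "norm (f (Suc k)) = (g \<circ> (\<lambda>k. k * N)) k" for k
    by (simp add: f_def g_def add.commute)
  have gN: "summable (g \<circ> (\<lambda>k. k * N))"
    by (rule summable_reindex[OF g inj]) (simp add: g_def)
  have f: "summable f"
    using gN summable_Suc_iff[of f] summable_norm_cancel[of "\<lambda>k. f (Suc k)"]
    unfolding tail_f[symmetric, abs_def] by simp
  have dom: "f k \<in> C_infinity T" for k
    unfolding f_def using y(1) by (rule S_iterate_C_infinity)
  have sm: "summable (\<lambda>k. (snd T ^^ n) (f k))" for n
  proof -
    have "\<forall>\<^sub>F k in sequentially. (snd T ^^ n) (f k) = (S ^^ (k * N - n)) y"
      using eventually_ge_at_top[of n]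
    proof eventually_elim
      case (elim k)
      have "n \<le> k * N" using elim N by (metis le_trans mult.right_neutral mult_le_mono2)
      then show ?case by (simp add: f_def T_iterate_S_iterate)
    qed
    moreover have "summable (\<lambda>k. (S ^^ (k * N - n)) y)"
    proof -
      have "inj (\<lambda>k. k * N + c)" for c using N by (auto simp: inj_on_def)
      then have "summable (\<lambda>k. norm ((S ^^ (k * N + (n * N - n))) y))"
        using summable_reindex[OF summable_S, of "\<lambda>k. k * N + (n * N - n)"]
        by (simp add: comp_def)
      moreover have "(k + n) * N - n = k * N + (n * N - n)" for k
        using N by (simp add: add_mult_distrib)
      ultimately have "summable (\<lambda>k. norm ((S ^^ ((k + n) * N - n)) y))" by simp
      then have "summable (\<lambda>k. (S ^^ ((k + n) * N - n)) y)" by (rule summable_norm_cancel)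
      then show ?thesis by (subst (asm) summable_iff_shift)
    qed
    ultimately show ?thesis by (subst summable_cong)
  qed
  define p where "p = suminf f"
  have p: "p \<in> C_infinity T" "(snd T ^^ N) p = (\<Sum>k. (snd T ^^ N) (f k))"
    unfolding p_def using suminf_C_infinity[OF dom sm] by auto
  have TN0: "(snd T ^^ N) (f 0) = 0"
    using T_iterate_zero_mono[OF y(2) N(2)] by (simp add: f_def)
  have TNS: "(snd T ^^ N) (f (Suc k)) = f k" for k
    unfolding f_def by (subst T_iterate_S_iterate(1)) auto
  have "(\<Sum>k. (snd T ^^ N) (f k)) = p"
    using suminf_split_head[OF sm[of N]] by (simp add: TN0 TNS p_def)
  then have per: "periodic_point T p"
    using p N(1) unfolding periodic_point_def C_infinity_def by auto
  have "p - y = (\<Sum>k. f (Suc k))"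
    using suminf_split_head[OF f] by (simp add: p_def f_def)
  then have "norm (p - y) \<le> (\<Sum>k. norm (f (Suc k)))"
    using summable_norm[of "\<lambda>k. f (Suc k)"] gN by (simp add: tail_f comp_def)
  also have "\<dots> \<le> suminf g"
    unfolding tail_f by (rule suminf_reindex_mono[OF g inj]) (simp add: g_def)
  also have "\<dots> < e" using N0[OF N(3)] by (simp add: g_def[abs_def])
  finally have "norm (p - y) < e" .
  with per show thesis by (rule that)
qed

text \<open>
  The vector is the series of \<open>(S ^^ N k) (y k)\<close>, where \<open>y\<close> enumerates \<open>E\<close>. At time \<open>N j\<close> the
  terms with \<open>k < j\<close> have vanished, the term \<open>k = j\<close> has become \<open>y j\<close>, and the terms with
  \<open>k > j\<close> have sum at most \<open>(1/2) ^ Suc j\<close>. This requires gaps \<open>N k - N j\<close> of size at least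
  \<open>d j\<close> (to annihilate \<open>y j\<close>) and at least \<open>M k\<close> (to make \<open>y k\<close> small).
\<close>

lemma hypercyclic_if_nilpotent_dense:
  assumes E: "countable E" "closure E = UNIV"
    and smooth: "\<And>y. y \<in> E \<Longrightarrow> y \<in> C_infinity T"
    and nilp: "\<And>y. y \<in> E \<Longrightarrow> \<exists>d. (snd T ^^ d) y = 0"
    and nontriv: "\<exists>v::'x. v \<noteq> 0"
  shows "hypercyclic T"
proof -
  have "E \<noteq> {}" using E(2) by auto
  \<comment> \<open>Decoding \<open>k\<close> as a pair and dropping the second component makes \<open>y\<close> hit every element
    of \<open>E\<close> at arbitrarily late indices.\<close>
  define y where "y k = from_nat_into E (fst (prod_decode k))" for k
  have yE: "y k \<in> E" for k
    unfolding y_def by (rule from_nat_into[OF \<open>E \<noteq> {}\<close>])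
  have "\<exists>d. (snd T ^^ d) (y k) = 0" for k using nilp[OF yE] .
  then obtain d where d: "\<And>k. (snd T ^^ d k) (y k) = 0" by metis
  have "\<exists>M. \<forall>m\<ge>M. norm ((S ^^ m) (y k)) < (1/2) ^ Suc k" for k
    using LIMSEQ_D[OF summable_LIMSEQ_zero[OF summable_S], of "(1/2) ^ Suc k"]
    by auto
  then obtain M where M: "\<And>k m. m \<ge> M k \<Longrightarrow> norm ((S ^^ m) (y k)) < (1/2) ^ Suc k"
    by metis
  \<comment> \<open>The summand \<open>k\<close> makes \<open>N\<close> unbounded, so that \<open>T ^^ n\<close> can be applied termwise for
    every \<open>n\<close>; the two sums provide the gaps.\<close>
  define N where "N k = k + (\<Sum>i\<le>k. M i) + (\<Sum>i<k. d i)" for k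
  have gap: "N j + M k + d j \<le> N k" if "j < k" for j k
  proof -
    have "(\<Sum>i\<le>j. M i) + M k = sum M (insert k {..j})" using that by simp
    also have "\<dots> \<le> (\<Sum>i\<le>k. M i)" using that by (intro sum_mono2) auto
    finally have 1: "(\<Sum>i\<le>j. M i) + M k \<le> (\<Sum>i\<le>k. M i)" .
    have "(\<Sum>i<j. d i) + d j = sum d {..<Suc j}" by simp
    also have "\<dots> \<le> (\<Sum>i<k. d i)" using that by (intro sum_mono2) auto
    finally show ?thesis using 1 that by (simp add: N_def)
  qed
  have N_ge: "k \<le> N k" "M k \<le> N k" for k
    by (auto simp: N_def atMost_Suc intro: trans_le_add1 trans_le_add2 member_le_sum)
  define f where "f k = (S ^^ N k) (y k)" for k
  have dom: "f k \<in> C_infinity T" for k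
    unfolding f_def using smooth[OF yE] by (rule S_iterate_C_infinity)
  have small: "norm ((snd T ^^ n) (f k)) \<le> (1/2) ^ Suc k" if "n + M k \<le> N k" for n k
    using that M[of k "N k - n"] by (simp add: f_def T_iterate_S_iterate less_imp_le)
  have sgeo: "summable (\<lambda>k. (1/2::real) ^ Suc k)"
    by (simp add: summable_geometric)
  have sm: "summable (\<lambda>k. (snd T ^^ n) (f k))" for n
  proof (rule summable_comparison_test'[OF sgeo])
    fix k assume "k \<ge> Suc n"
    then have "n + M k \<le> N k" using gap[of n k] N_ge[of n] by simp
    then show "norm ((snd T ^^ n) (f k)) \<le> (1/2) ^ Suc k" by (rule small)
  qed
  define x where "x = suminf f"
  have x: "x \<in> C_infinity T" "(snd T ^^ n) x = (\<Sum>k. (snd T ^^ n) (f k))" for n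
    unfolding x_def using suminf_C_infinity[OF dom sm] by auto
  have near: "norm ((snd T ^^ N j) x - y j) \<le> (1/2) ^ Suc j" for j
  proof -
    define g where "g k = (snd T ^^ N j) (f k)" for k
    have g: "summable g" unfolding g_def by (rule sm)
    have past: "g k = 0" if "k < j" for k
      using gap[OF that] T_iterate_zero_mono[OF d, of k "N j - N k"]
      by (simp add: g_def f_def T_iterate_S_iterate)
    have present: "g j = y j" by (simp add: g_def f_def T_iterate_S_iterate)
    have future: "norm (g (k + Suc j)) \<le> (1/2) ^ Suc (k + Suc j)" for k
      unfolding g_def by (rule small) (use gap[of j "k + Suc j"] in simp)
    have "(snd T ^^ N j) x = suminf g" using x(2) by (simp add: g_def[abs_def])
    also have "\<dots> = (\<Sum>k. g (k + Suc j)) + (\<Sum>k<Suc j. g k)"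
      by (rule suminf_split_initial_segment[OF g])
    finally have "(snd T ^^ N j) x - y j = (\<Sum>k. g (k + Suc j))"
      by (simp add: past present)
    also have "norm \<dots> \<le> (\<Sum>k. (1/2) ^ Suc (k + Suc j))"
      by (rule norm_suminf_le[OF future]) (rule summable_ignore_initial_segment[OF sgeo])
    also have "(\<Sum>k. (1/2::real) ^ Suc (k + Suc j)) = (\<Sum>k. (1/2) ^ k * (1/2) ^ (j + 2))"
      by (simp add: power_add mult_ac)
    also have "\<dots> = (1/2) ^ Suc j"
      by (subst suminf_mult2[symmetric]) (auto simp: suminf_geometric)
    finally show ?thesis .
  qed
  have dense: "\<exists>n. norm ((snd T ^^ n) x - v) < e" if "e > 0" for v e
  proof -
    obtain u where u: "u \<in> E" "norm (u - v) < e / 2"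
      using E(2) \<open>e > 0\<close> closure_approachable[of v E] by (metis UNIV_I dist_norm half_gt_zero)
    obtain l where l: "(1/2::real) ^ l < e / 2"
      using real_arch_pow_inv[of "e / 2" "1/2"] \<open>e > 0\<close> by auto
    define j where "j = prod_encode (to_nat_on E u, l)"
    have "y j = u" using u E(1) by (simp add: y_def j_def)
    have "l \<le> Suc j" by (simp add: j_def le_prod_encode_2 le_SucI)
    then have "(1/2::real) ^ Suc j \<le> (1/2) ^ l" by (intro power_decreasing) auto
    then have "norm ((snd T ^^ N j) x - u) < e / 2" using near[of j] l \<open>y j = u\<close> by simp
    then have "norm ((snd T ^^ N j) x - v) < e"
      using u(2) norm_triangle_ineq[of "(snd T ^^ N j) x - u" "u - v"] by simp
    then show ?thesis ..
  qed
  have "x \<noteq> 0"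
  proof
    assume "x = 0"
    obtain v :: 'x where "v \<noteq> 0" using nontriv by blast
    then show False using dense[of "norm v" v] by (simp add: \<open>x = 0\<close> T_iterate_zero)
  qed
  moreover have "closure (range (\<lambda>n. (snd T ^^ n) x)) = UNIV"
    using dense by (auto simp: closure_approachable dist_norm)
  ultimately show ?thesis
    using x(1) unfolding hypercyclic_def hypercyclic_vector_def by blast
qed

theorem chaotic_if_nilpotent_dense:
  assumes "countable E" "closure E = UNIV"
    and "\<And>y. y \<in> E \<Longrightarrow> y \<in> C_infinity T"
    and "\<And>y. y \<in> E \<Longrightarrow> \<exists>d. (snd T ^^ d) y = 0"
    and "\<exists>v::'x. v \<noteq> 0"
  shows "chaotic T"
proof -
  have "v \<in> closure {p. periodic_point T p}" for v
    unfolding closure_approachable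
  proof (intro allI impI)
    fix e :: real assume "e > 0"
    then obtain y where y: "y \<in> E" "dist y v < e / 2"
      using assms(2) closure_approachable[of v E] by (metis UNIV_I half_gt_zero)
    moreover obtain d where "(snd T ^^ d) y = 0" using assms(4)[OF y(1)] ..
    ultimately obtain p where "periodic_point T p" "norm (p - y) < e / 2"
      using periodic_point_near[OF assms(3)[OF y(1)], of d "e / 2"] \<open>e > 0\<close> by auto
    then show "\<exists>p\<in>{p. periodic_point T p}. dist p v < e"
      using y(2) dist_triangle_half_r[of y p e v] by (auto simp: dist_norm norm_minus_commute)
  qed
  then show ?thesis
    using hypercyclic_if_nilpotent_dense[OF assms] unfolding chaotic_def by auto
qed

end

section \<open>The weighted translation as a closed operator\<close>

lemma continuous_c0_apply: "continuous_on {0..} (c0_apply x)"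
  and tendsto_c0_apply: "(c0_apply x \<longlongrightarrow> 0) at_top"
  using c0_apply[of x] by auto

lemma c0_apply_Abs:
  assumes "continuous_on {0..} g" "(g \<longlongrightarrow> 0) at_top" "t \<ge> 0"
  shows "c0_apply (Abs_c0 (\<lambda>t. if t < 0 then 0 else g t)) t = g t"
proof -
  have "continuous_on {0..} (\<lambda>t. if t < 0 then 0 else g t)"
    using assms(1) by (rule continuous_on_eq) auto
  moreover have "((\<lambda>t. if t < 0 then 0 else g t) \<longlongrightarrow> 0) at_top"
    by (rule Lim_transform_eventually[OF assms(2)])
      (use eventually_ge_at_top[of 0] in eventually_elim, auto)
  ultimately show ?thesis using assms(3) by (simp add: Abs_c0_inverse)
qed

lemma bounded_linear_c0_apply: "bounded_linear (\<lambda>x. c0_apply x t)"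
  by (rule bounded_linear_intro[where K = 1]) (auto simp: c0_norm_upper)

lemma bounded_linear_scale_c0: "bounded_linear (scale_c0 c)"
  by (rule bounded_linear_intro[where K = "norm c"])
    (auto intro!: c0_eqI simp: norm_scale_c0 algebra_simps)

lemma translation_domain_iff:
  "x \<in> fst (translation w a) \<longleftrightarrow> ((\<lambda>t. (w powr t) *\<^sub>R c0_apply x (t + a)) \<longlongrightarrow> 0) at_top"
  by (simp add: translation_def)

text \<open>
  An element of the space that is given pointwise by the formula of the translation tends to
  \<open>0\<close> at infinity, and this is exactly the domain condition. Hence exhibiting such an element
  settles domain membership and the value of the operator at once.
\<close>

lemma translation_domainI:
  fixes x y :: "'k::real_normed_vector c0"
  assumes "w > 0" "a \<ge> 0" "\<And>t. t \<ge> 0 \<Longrightarrow> c0_apply y t = (w powr t) *\<^sub>R c0_apply x (t + a)"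
  shows "x \<in> fst (translation w a)" "snd (translation w a) x = y"
proof -
  show dom: "x \<in> fst (translation w a)"
    unfolding translation_domain_iff
    by (rule Lim_transform_eventually[OF tendsto_c0_apply[of y]])
      (use eventually_ge_at_top[of 0] in eventually_elim, auto simp: assms(3))
  show "snd (translation w a) x = y"
    by (rule c0_eqI) (simp add: translation_apply[OF assms(1,2) dom] assms(3))
qed

lemma translation_add:
  assumes "w > 0" "a \<ge> 0" "x \<in> fst (translation w a)" "y \<in> fst (translation w a)"
  shows "x + y \<in> fst (translation w a)"
    and "snd (translation w a) (x + y) = snd (translation w a) x + snd (translation w a) y"
proof -
  have "c0_apply (snd (translation w a) x + snd (translation w a) y) t
      = (w powr t) *\<^sub>R c0_apply (x + y) (t + a)" if "t \<ge> 0" for t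
    by (simp add: translation_apply[OF assms(1,2)] assms(3,4) that scaleR_right_distrib)
  from translation_domainI[OF assms(1,2) this]
  show "x + y \<in> fst (translation w a)"
    "snd (translation w a) (x + y) = snd (translation w a) x + snd (translation w a) y" by auto
qed

lemma translation_scaleR:
  assumes "w > 0" "a \<ge> 0" "x \<in> fst (translation w a)"
  shows "r *\<^sub>R x \<in> fst (translation w a)"
    and "snd (translation w a) (r *\<^sub>R x) = r *\<^sub>R snd (translation w a) x"
proof -
  have "c0_apply (r *\<^sub>R snd (translation w a) x) t = (w powr t) *\<^sub>R c0_apply (r *\<^sub>R x) (t + a)"
    if "t \<ge> 0" for t
    by (simp add: translation_apply[OF assms] that)
  from translation_domainI[OF assms(1,2) this]
  show "r *\<^sub>R x \<in> fst (translation w a)"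
    "snd (translation w a) (r *\<^sub>R x) = r *\<^sub>R snd (translation w a) x" by auto
qed

lemma translation_scale_c0:
  assumes "w > 0" "a \<ge> 0" "x \<in> fst (translation w a)"
  shows "scale_c0 c x \<in> fst (translation w a)"
    and "snd (translation w a) (scale_c0 c x) = scale_c0 c (snd (translation w a) x)"
proof -
  have "c0_apply (scale_c0 c (snd (translation w a) x)) t
      = (w powr t) *\<^sub>R c0_apply (scale_c0 c x) (t + a)" if "t \<ge> 0" for t
    by (simp add: translation_apply[OF assms] that)
  from translation_domainI[OF assms(1,2) this]
  show "scale_c0 c x \<in> fst (translation w a)"
    "snd (translation w a) (scale_c0 c x) = scale_c0 c (snd (translation w a) x)" by auto
qed

lemma zero_translation_domain: "0 \<in> fst (translation w a)"
  by (simp add: translation_domain_iff)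

lemma linear_operator_translation_real:
  assumes "w > 0" "a \<ge> 0"
  shows "linear_operator (*\<^sub>R) (translation w a)"
  unfolding linear_operator_def subspace_raw_def[symmetric] subspace_def
  using translation_add[OF assms] translation_scaleR[OF assms] zero_translation_domain by blast

lemma linear_operator_translation:
  assumes "w > 0" "a \<ge> 0"
  shows "linear_operator scale_c0 (translation w a :: 'k::{real_normed_field,banach} c0 operator)"
proof -
  interpret c0: vector_space "scale_c0 :: 'k \<Rightarrow> 'k c0 \<Rightarrow> 'k c0" by (rule vector_space_scale_c0)
  show ?thesis
    unfolding linear_operator_def c0.subspace_def
    using translation_add[OF assms] translation_scale_c0[OF assms] zero_translation_domain by blast
qed

text \<open>
  Norm convergence implies pointwise convergence, and for fixed \<open>t\<close> the defining formula is
  continuous in the value at \<open>t + a\<close>; so the limits again satisfy the formula.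
\<close>

lemma closed_graph_translation:
  assumes "w > 0" "a \<ge> 0"
  shows "closed (operator_graph (translation w a :: 'k::banach c0 operator))"
  unfolding closed_sequential_limits
proof (intro allI impI, elim conjE)
  let ?T = "translation w a :: 'k c0 operator"
  fix z :: "nat \<Rightarrow> 'k c0 \<times> 'k c0" and l
  assume z: "\<forall>n. z n \<in> operator_graph ?T" and lim: "z \<longlonglongrightarrow> l"
  define x where "x n = fst (z n)" for n
  have x: "x n \<in> fst ?T" "z n = (x n, snd ?T (x n))" for n
    using z[rule_format, of n] by (auto simp: operator_graph_def x_def)
  have "(\<lambda>n. c0_apply (x n) t) \<longlonglongrightarrow> c0_apply (fst l) t" for t
    unfolding x_def by (intro bounded_linear.tendsto[OF bounded_linear_c0_apply] tendsto_fst lim)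
  then have "(\<lambda>n. (w powr t) *\<^sub>R c0_apply (x n) (t + a))
      \<longlonglongrightarrow> (w powr t) *\<^sub>R c0_apply (fst l) (t + a)" for t
    by (intro tendsto_intros)
  moreover have "(\<lambda>n. c0_apply (snd (z n)) t) \<longlonglongrightarrow> c0_apply (snd l) t" for t
    by (intro bounded_linear.tendsto[OF bounded_linear_c0_apply] tendsto_snd lim)
  then have "(\<lambda>n. (w powr t) *\<^sub>R c0_apply (x n) (t + a)) \<longlonglongrightarrow> c0_apply (snd l) t" if "t \<ge> 0" for t
    unfolding translation_apply[OF assms x(1) that, symmetric] by (simp add: x(2))
  ultimately have "c0_apply (snd l) t = (w powr t) *\<^sub>R c0_apply (fst l) (t + a)" if "t \<ge> 0" for t
    using that LIMSEQ_unique by blast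
  from translation_domainI[OF assms this] show "l \<in> operator_graph ?T"
    unfolding operator_graph_def by (auto intro!: image_eqI[of _ _ "fst l"] simp: prod_eq_iff)
qed

section \<open>A right inverse with rapidly decaying powers\<close>

text \<open>
  At \<open>t = a\<close> both branches equal \<open>x 0\<close>. Any continuous filling of \<open>[0, a]\<close> with this end value
  would give a right inverse; the ramp is chosen because it starts at \<open>0\<close>, which produces the
  growing zero intervals of the iterates. Filling with the constant \<open>x 0\<close> would leave the
  value at \<open>0\<close> the same in all iterates, so that they could not decay.
\<close>

definition ramp_inverse :: "real \<Rightarrow> real \<Rightarrow> 'k::real_normed_vector c0 \<Rightarrow> 'k c0" where
  "ramp_inverse w a x = Abs_c0 (\<lambda>t. if t < 0 then 0 else
     if t \<le> a then (t / a) *\<^sub>R c0_apply x 0 else (w powr (a - t)) *\<^sub>R c0_apply x (t - a))"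

lemma ramp_inverse_apply:
  assumes "w > 1" "a > 0" "t \<ge> 0"
  shows "c0_apply (ramp_inverse w a x) t =
    (if t \<le> a then (t / a) *\<^sub>R c0_apply x 0 else (w powr (a - t)) *\<^sub>R c0_apply x (t - a))"
  unfolding ramp_inverse_def
proof (rule c0_apply_Abs[OF _ _ assms(3)])
  let ?g = "\<lambda>t. if t \<le> a then (t / a) *\<^sub>R c0_apply x 0 else (w powr (a - t)) *\<^sub>R c0_apply x (t - a)"
  have "continuous_on ({0..a} \<union> {a..}) ?g"
  proof (rule continuous_on_cases)
    have "continuous_on {a..} (\<lambda>t. c0_apply x (t - a))"
      by (rule continuous_on_compose2[OF continuous_c0_apply]) (auto intro!: continuous_intros)
    then show "continuous_on {a..} (\<lambda>t. (w powr (a - t)) *\<^sub>R c0_apply x (t - a))"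
      using assms by (intro continuous_intros) auto
  qed (use assms in \<open>auto intro!: continuous_intros\<close>)
  moreover have "{0..a} \<union> {a..} = {0..}" using assms by auto
  ultimately show "continuous_on {0..} ?g" by simp
  have "((\<lambda>t. c0_apply x (t - a)) \<longlongrightarrow> 0) at_top"
    by (rule filterlim_compose[OF tendsto_c0_apply])
      (auto intro!: filterlim_tendsto_add_at_top[of "\<lambda>_. -a", simplified] filterlim_ident)
  then show "(?g \<longlongrightarrow> 0) at_top"
  proof (rule Lim_null_comparison[rotated, OF tendsto_norm_zero])
    show "\<forall>\<^sub>F t in at_top. norm (?g t) \<le> norm (c0_apply x (t - a))"
      using eventually_gt_at_top[of a]
    proof eventually_elim
      case (elim t)
      have "w powr (a - t) \<le> w powr 0" using elim assms by (intro powr_mono) auto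
      then show ?case using elim assms by (simp add: mult_left_le_one_le)
    qed
  qed
qed

lemma translation_ramp_inverse:
  fixes x :: "'k::real_normed_vector c0"
  assumes "w > 1" "a > 0"
  shows "ramp_inverse w a x \<in> fst (translation w a)"
    and "snd (translation w a) (ramp_inverse w a x) = x"
proof -
  have "c0_apply x t = (w powr t) *\<^sub>R c0_apply (ramp_inverse w a x) (t + a)" if "t \<ge> 0" for t
    using assms that by (auto simp: ramp_inverse_apply powr_add[symmetric])
  from translation_domainI[OF _ _ this] assms
  show "ramp_inverse w a x \<in> fst (translation w a)"
    "snd (translation w a) (ramp_inverse w a x) = x" by auto
qed

lemma ramp_inverse_vanishes:
  assumes "w > 1" "a > 0" "\<And>t. 0 \<le> t \<Longrightarrow> t \<le> b \<Longrightarrow> c0_apply x t = 0" "b \<ge> 0" "0 \<le> t" "t \<le> b + a"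
  shows "c0_apply (ramp_inverse w a x) t = 0"
  using assms by (simp add: ramp_inverse_apply)

lemma ramp_inverse_power_vanishes:
  assumes "w > 1" "a > 0" "0 \<le> t" "t \<le> real m * a"
  shows "c0_apply ((ramp_inverse w a ^^ Suc m) x) t = 0"
  using assms(3,4)
proof (induction m arbitrary: t)
  case 0
  then show ?case using assms by (simp add: ramp_inverse_apply)
next
  case (Suc m)
  show ?case unfolding funpow.simps(2)[of "Suc m"] comp_apply
    by (rule ramp_inverse_vanishes[OF assms(1,2) Suc.IH])
      (use Suc.prems assms in \<open>auto simp: algebra_simps\<close>)
qed

text \<open>
  For \<open>t > a + b\<close> the factor \<open>w powr (a - t)\<close> is at most \<open>w powr - b\<close>, and elsewhere the image
  is \<open>0\<close>: the ramp is \<open>0\<close> because \<open>x 0 = 0\<close>.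
\<close>

lemma norm_ramp_inverse_le:
  assumes "w > 1" "a > 0" "b \<ge> 0" "\<And>t. 0 \<le> t \<Longrightarrow> t \<le> b \<Longrightarrow> c0_apply x t = 0"
  shows "norm (ramp_inverse w a x) \<le> (w powr - b) * norm x"
proof (rule c0_norm_least)
  fix t :: real assume t: "t \<ge> 0"
  show "norm (c0_apply (ramp_inverse w a x) t) \<le> (w powr - b) * norm x"
  proof (cases "t \<le> b + a")
    case True
    then have "c0_apply (ramp_inverse w a x) t = 0"
      using assms t by (intro ramp_inverse_vanishes)
    then show ?thesis by simp
  next
    case False
    have "w powr (a - t) \<le> w powr (- b)" using False assms by (intro powr_mono) auto
    then have "(w powr (a - t)) * norm (c0_apply x (t - a)) \<le> (w powr - b) * norm x"
      by (intro mult_mono c0_norm_upper) auto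
    then show ?thesis using False assms t by (simp add: ramp_inverse_apply)
  qed
qed

text \<open>
  From the first iterate on, passing from \<open>m\<close> to \<open>m + 1\<close> multiplies the norm by at most
  \<open>w powr - ((m - 1) * a)\<close>, which tends to \<open>0\<close>. So the ratio test applies for every \<open>c\<close>;
  arbitrary \<open>c\<close> is what allows every scalar to be an eigenvalue.
\<close>

lemma summable_ramp_inverse_powers:
  fixes x :: "'k::real_normed_vector c0"
  assumes "w > 1" "a > 0"
  shows "summable (\<lambda>m. c ^ m * norm ((ramp_inverse w a ^^ m) x))"
proof -
  let ?S = "ramp_inverse w a :: 'k c0 \<Rightarrow> 'k c0"
  have "(\<lambda>m. \<bar>c\<bar> * (w powr - a) ^ m) \<longlonglongrightarrow> 0"
    using assms by (intro tendsto_mult_right_zero LIMSEQ_realpow_zero) (auto simp: powr_less_one)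
  then have "\<forall>\<^sub>F m in sequentially. \<bar>c\<bar> * (w powr - a) ^ m < 1 / 2"
    by (rule order_tendstoD) simp
  then obtain M where M: "\<And>m. m \<ge> M \<Longrightarrow> \<bar>c\<bar> * (w powr - a) ^ m < 1 / 2"
    unfolding eventually_sequentially by blast
  have "norm (c ^ Suc m * norm ((?S ^^ Suc m) x)) \<le> 1 / 2 * norm (c ^ m * norm ((?S ^^ m) x))"
    if m: "m \<ge> Suc M" for m
  proof -
    obtain k where k: "m = Suc k" "k \<ge> M" using m by (cases m) auto
    have "norm ((?S ^^ Suc m) x) \<le> (w powr - (real k * a)) * norm ((?S ^^ m) x)"
      unfolding k(1) funpow.simps(2)[of "Suc k"] comp_apply
      by (intro norm_ramp_inverse_le assms ramp_inverse_power_vanishes)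
        (use assms in auto)
    also have "w powr - (real k * a) = (w powr - a) ^ k"
      using assms by (simp add: powr_power mult.commute)
    finally have "norm (c ^ Suc m * norm ((?S ^^ Suc m) x))
        \<le> \<bar>c\<bar> ^ Suc m * ((w powr - a) ^ k * norm ((?S ^^ m) x))"
      by (simp add: abs_mult power_abs mult_left_mono del: funpow.simps)
    also have "\<dots> = (\<bar>c\<bar> * (w powr - a) ^ k) * (\<bar>c\<bar> ^ m * norm ((?S ^^ m) x))"
      by (simp add: mult_ac del: funpow.simps)
    also have "\<dots> \<le> 1 / 2 * (\<bar>c\<bar> ^ m * norm ((?S ^^ m) x))"
      using M[OF k(2)] by (intro mult_right_mono) auto
    finally show ?thesis by (simp add: abs_mult power_abs del: funpow.simps)
  qed
  then show ?thesis by (intro summable_ratio_test[of "1/2"]) auto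
qed

lemma right_invertible_translation:
  assumes "w > 1" "a > 0"
  shows "summably_right_invertible (translation w a :: 'k::banach c0 operator) (ramp_inverse w a)"
proof
  fix x :: "'k c0"
  show "summable (\<lambda>m. norm ((ramp_inverse w a ^^ m) x))"
    using summable_ramp_inverse_powers[OF assms, of 1 x] by simp
qed (use assms translation_ramp_inverse in
    \<open>auto intro!: linear_operator_translation_real closed_graph_translation\<close>)

section \<open>A countable dense set of functions with bounded support\<close>

definition hat :: "real \<Rightarrow> real" where
  "hat u = max 0 (1 - \<bar>u\<bar>)"

definition bump :: "real \<Rightarrow> real \<Rightarrow> 'k::real_normed_field c0" where
  "bump c s = Abs_c0 (\<lambda>t. if t < 0 then 0 else of_real (hat (s * (t - c))))"

lemma bump_apply:
  assumes "s > 0" "t \<ge> 0"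
  shows "c0_apply (bump c s) t = of_real (hat (s * (t - c)))"
  unfolding bump_def
proof (rule c0_apply_Abs[OF _ _ assms(2)])
  show "continuous_on {0..} (\<lambda>t. of_real (hat (s * (t - c))) :: 'a)"
    unfolding hat_def by (intro continuous_intros continuous_on_of_real continuous_on_max)
  have "\<forall>\<^sub>F t in at_top. of_real (hat (s * (t - c))) = (0::'a)"
    using eventually_ge_at_top[of "c + 1 / s"]
  proof eventually_elim
    case (elim t)
    then have "s * (t - c) \<ge> 1" using assms by (simp add: field_simps)
    then show ?case by (simp add: hat_def)
  qed
  then show "((\<lambda>t. of_real (hat (s * (t - c)))) \<longlongrightarrow> (0::'a)) at_top"
    by (rule tendsto_eventually)
qed

text \<open>
  The hats centred at all natural numbers form a partition of unity, and the remainder after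
  \<open>L\<close> of them is a ramp that is \<open>0\<close> up to \<open>L - 1\<close>. It telescopes, since \<open>hat u\<close> is the
  difference of the values at \<open>u + 1\<close> and \<open>u\<close> of the function that truncates to \<open>[0, 1]\<close>.
\<close>

lemma sum_hat:
  assumes "s \<ge> 0"
  shows "(\<Sum>i<L. hat (s - real i)) = 1 - max 0 (min 1 (s - real L + 1))"
proof (induction L)
  case (Suc L)
  then show ?case by (auto simp: hat_def max_def min_def abs_if)
qed (use assms in simp)

text \<open>
  The piecewise linear function with the values \<open>cs ! i\<close> at the nodes \<open>i / n\<close> and \<open>0\<close> at all
  later nodes.
\<close>

definition interpolant :: "nat \<Rightarrow> 'k::real_normed_field list \<Rightarrow> 'k c0" where
  "interpolant n cs = (\<Sum>i<length cs. scale_c0 (cs ! i) (bump (real i / real n) (real n)))"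

lemma interpolant_apply:
  assumes "n > 0" "t \<ge> 0"
  shows "c0_apply (interpolant n cs) t = (\<Sum>i<length cs. cs ! i * of_real (hat (real n * t - real i)))"
proof -
  have "c0_apply (interpolant n cs) t =
      (\<Sum>i<length cs. c0_apply (scale_c0 (cs ! i) (bump (real i / real n) (real n))) t)"
    unfolding interpolant_def by (rule linear_sum[OF bounded_linear.linear[OF bounded_linear_c0_apply]])
  then show ?thesis
    using assms by (simp add: bump_apply right_diff_distrib)
qed

lemma interpolant_vanishes:
  assumes "n > 0" "t \<ge> real (length cs)"
  shows "c0_apply (interpolant n cs) t = 0"
proof -
  have "hat (real n * t - real i) = 0" if "i < length cs" for i
  proof -
    have "t \<le> real n * t" using assms by (simp add: mult_le_cancel_right1)
    with that assms(2) have "real n * t - real i \<ge> 1" by linarith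
    then show ?thesis by (simp add: hat_def)
  qed
  then show ?thesis using assms by (simp add: interpolant_apply)
qed

lemma c0_uniformly_continuous:
  assumes "e > 0"
  obtains r where "r > 0"
    "\<And>s t. s \<ge> 0 \<Longrightarrow> t \<ge> 0 \<Longrightarrow> \<bar>s - t\<bar> < r \<Longrightarrow> norm (c0_apply x s - c0_apply x t) < e"
proof -
  have "\<forall>\<^sub>F t in at_top. dist (c0_apply x t) 0 < e / 2"
    using tendsto_c0_apply assms by (intro tendstoD) auto
  then obtain b where b: "\<And>t. t \<ge> b \<Longrightarrow> norm (c0_apply x t) < e / 2"
    by (auto simp: eventually_at_top_linorder)
  have "uniformly_continuous_on {0..b + 1} (c0_apply x)"
    by (intro compact_uniformly_continuous continuous_on_subset[OF continuous_c0_apply]) auto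
  then obtain r where r: "r > 0" "\<And>s t. s \<in> {0..b + 1} \<Longrightarrow> t \<in> {0..b + 1} \<Longrightarrow> dist t s < r
      \<Longrightarrow> dist (c0_apply x t) (c0_apply x s) < e"
    unfolding uniformly_continuous_on_def using assms by metis
  show thesis
  proof (rule that[of "min r 1"])
    fix s t :: real assume st: "s \<ge> 0" "t \<ge> 0" "\<bar>s - t\<bar> < min r 1"
    show "norm (c0_apply x s - c0_apply x t) < e"
    proof (cases "s \<le> b + 1 \<and> t \<le> b + 1")
      case True
      then show ?thesis using r(2)[of t s] st by (simp add: dist_norm)
    next
      case False
      then have "s \<ge> b" "t \<ge> b" using st by auto
      then show ?thesis
        using b[of s] b[of t] norm_triangle_ineq4[of "c0_apply x s" "c0_apply x t"] by simp
    qed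
  qed (use r in simp)
qed

text \<open>
  By the partition of unity the error at \<open>t\<close> is an average of the differences \<open>x t - c i\<close> over
  nodes within \<open>1 / n\<close> of \<open>t\<close>, which are small by uniform continuity, and of \<open>x t\<close> itself with
  a weight that is positive only for large \<open>t\<close>, where \<open>x\<close> is small.
\<close>

lemma interpolant_near:
  fixes x :: "'k::real_normed_field c0"
  assumes D: "\<And>U::'k set. open U \<Longrightarrow> U \<noteq> {} \<Longrightarrow> \<exists>d\<in>D. d \<in> U" and "e > 0"
  obtains n cs where "n > 0" "set cs \<subseteq> D" "norm (x - interpolant n cs) \<le> e"
proof -
  obtain r where r: "r > 0" "\<And>s t. s \<ge> 0 \<Longrightarrow> t \<ge> 0 \<Longrightarrow> \<bar>s - t\<bar> < r
      \<Longrightarrow> norm (c0_apply x s - c0_apply x t) < e / 2"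
    using c0_uniformly_continuous[of "e / 2" x] \<open>e > 0\<close> by (metis half_gt_zero)
  have "\<forall>\<^sub>F t in at_top. dist (c0_apply x t) 0 < e"
    using tendsto_c0_apply \<open>e > 0\<close> by (intro tendstoD) auto
  then obtain b where b: "\<And>t. t \<ge> b \<Longrightarrow> norm (c0_apply x t) < e"
    by (auto simp: eventually_at_top_linorder)
  obtain n where n: "n > 0" "1 / real n < r"
    using reals_Archimedean[OF r(1)] by (metis inverse_eq_divide zero_less_Suc)
  obtain L where L: "b * real n + 1 \<le> real L" using real_arch_simple by blast
  have "\<exists>d\<in>D. d \<in> ball (c0_apply x (real i / real n)) (e / 2)" for i
    using \<open>e > 0\<close> by (intro D) auto
  then obtain c where c: "\<And>i. c i \<in> D" "\<And>i. norm (c0_apply x (real i / real n) - c i) < e / 2"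
    by (metis dist_norm mem_ball)
  have "norm (x - interpolant n (map c [0..<L])) \<le> e"
  proof (rule c0_norm_least)
    fix t :: real assume t: "t \<ge> 0"
    define h where "h i = hat (real n * t - real i)" for i :: nat
    define g where "g = max 0 (min 1 (real n * t - real L + 1))"
    have h0: "h i \<ge> 0" for i by (simp add: h_def hat_def)
    have g0: "g \<ge> 0" by (simp add: g_def)
    have one: "(\<Sum>i<L. h i) + g = 1"
      using sum_hat[of "real n * t" L] t by (simp add: h_def g_def)
    have near: "h i * norm (c0_apply x t - c i) \<le> h i * e" for i
    proof (cases "h i = 0")
      case False
      then have "\<bar>real n * t - real i\<bar> < 1" by (auto simp: h_def hat_def)
      moreover have "\<bar>t - real i / real n\<bar> = \<bar>real n * t - real i\<bar> / real n"
        using n by (simp add: abs_div_pos diff_divide_distrib)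
      ultimately have "\<bar>t - real i / real n\<bar> < 1 / real n"
        using n by (simp add: divide_strict_right_mono)
      then have "norm (c0_apply x t - c0_apply x (real i / real n)) < e / 2"
        using r(2)[of t "real i / real n"] t n by simp
      then have "norm (c0_apply x t - c i) \<le> e"
        using c(2)[of i] norm_triangle_ineq[of "c0_apply x t - c0_apply x (real i / real n)"
            "c0_apply x (real i / real n) - c i"] by simp
      then show ?thesis using h0 by (rule mult_left_mono)
    qed simp
    have far: "g * norm (c0_apply x t) \<le> g * e"
    proof (cases "g = 0")
      case False
      then have "b * real n \<le> t * real n" using L by (auto simp: g_def max_def min_def mult.commute split: if_splits)
      then have "b \<le> t" using n by simp
      then show ?thesis using b[of t] g0 by (intro mult_left_mono) auto
    qed simp
    have "c0_apply (x - interpolant n (map c [0..<L])) t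
        = c0_apply x t * of_real ((\<Sum>i<L. h i) + g) - (\<Sum>i<L. c i * of_real (h i))"
      unfolding one using n t by (simp add: interpolant_apply h_def)
    also have "\<dots> = (\<Sum>i<L. of_real (h i) * (c0_apply x t - c i)) + of_real g * c0_apply x t"
      by (simp add: algebra_simps sum_distrib_left sum_subtractf)
    also have "norm \<dots> \<le> (\<Sum>i<L. h i * norm (c0_apply x t - c i)) + g * norm (c0_apply x t)"
      by (intro norm_triangle_mono sum_norm_le) (auto simp: norm_mult h0 g0)
    also have "\<dots> \<le> (\<Sum>i<L. h i * e) + g * e"
      by (intro add_mono sum_mono near far)
    also have "\<dots> = e" using one by (metis distrib_right mult_1 sum_distrib_right)
    finally show "norm (c0_apply (x - interpolant n (map c [0..<L])) t) \<le> e" .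
  qed
  then show thesis using n c(1) by (intro that) auto
qed

lemma translation_domain_if_vanishes:
  assumes "\<And>t. t \<ge> b \<Longrightarrow> c0_apply x t = 0"
  shows "x \<in> fst (translation w a)"
  unfolding translation_domain_iff
  by (rule tendsto_eventually)
    (use eventually_ge_at_top[of "b - a"] in eventually_elim, auto simp: assms)

text \<open>
  Each application of the translation shortens the support by \<open>a\<close>.
\<close>

lemma translation_power_vanishes:
  assumes "w > 0" "a \<ge> 0" "\<And>t. t \<ge> b \<Longrightarrow> c0_apply x t = 0" "t \<ge> 0" "t \<ge> b - real n * a"
  shows "c0_apply ((snd (translation w a) ^^ n) x) t = 0"
  using assms(4,5)
proof (induction n arbitrary: t)
  case (Suc n)
  let ?y = "(snd (translation w a) ^^ n) x"
  have "?y \<in> fst (translation w a)"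
    by (rule translation_domain_if_vanishes[of "max 0 (b - real n * a)"]) (auto intro: Suc.IH)
  then show ?case
    using Suc.IH[of "t + a"] Suc.prems assms by (simp add: translation_apply algebra_simps)
qed (use assms in simp)

section \<open>Chaos, unboundedness and spectrum\<close>

lemma chaotic_translation:
  assumes "w > 1" "a > 0"
  shows "chaotic (translation w a :: 'k::{real_normed_field,banach,second_countable_topology} c0 operator)"
proof -
  let ?T = "translation w a :: 'k c0 operator"
  interpret summably_right_invertible ?T "ramp_inverse w a"
    by (rule right_invertible_translation[OF assms])
  obtain D :: "'k set" where D: "countable D"
    "\<And>U. open U \<Longrightarrow> U \<noteq> {} \<Longrightarrow> \<exists>d\<in>D. d \<in> U"
    by (rule countable_dense_setE) blast
  define E where "E = (\<lambda>(n, cs). interpolant n cs) ` ({0<..} \<times> lists D)"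
  show ?thesis
  proof (rule chaotic_if_nilpotent_dense)
    show "countable E"
      unfolding E_def using D(1) by (intro countable_image countable_SIGMA countable_lists) auto
    show "closure E = UNIV"
    proof -
      have "x \<in> closure E" for x
        unfolding closure_approachable
      proof (intro allI impI)
        fix e :: real assume "e > 0"
        then obtain n cs where "n > 0" "set cs \<subseteq> D" "norm (x - interpolant n cs) \<le> e / 2"
          using interpolant_near[OF D(2), of "e / 2" x] by auto
        with \<open>e > 0\<close> have "interpolant n cs \<in> E" "dist (interpolant n cs) x < e"
          unfolding E_def by (auto simp: dist_norm norm_minus_commute lists_eq_set intro!: image_eqI[of _ _ "(n, cs)"])
        then show "\<exists>y\<in>E. dist y x < e" ..
      qed
      then show ?thesis by blast
    qed
    fix y assume "y \<in> E"
    then obtain n cs where ncs: "n > 0" "y = interpolant n cs"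
      unfolding E_def by auto
    define b where "b = real (length cs)"
    have b: "c0_apply y t = 0" if "t \<ge> b" for t
      using that ncs by (simp add: b_def interpolant_vanishes)
    have van: "c0_apply ((snd ?T ^^ n) y) t = 0" if "t \<ge> 0" "t \<ge> b - real n * a" for n t
      using assms b that by (intro translation_power_vanishes[where b = b]) auto
    show "y \<in> C_infinity ?T"
      unfolding C_infinity_iff
    proof
      fix n show "(snd ?T ^^ n) y \<in> fst ?T"
        by (rule translation_domain_if_vanishes[of "max 0 (b - real n * a)"]) (auto intro: van)
    qed
    obtain d where "b / a \<le> real d" using real_arch_simple by blast
    then have "b \<le> real d * a" using assms by (simp add: field_simps)
    then have "(snd ?T ^^ d) y = 0" by (intro c0_eqI) (simp add: van)
    then show "\<exists>d. (snd ?T ^^ d) y = 0" ..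
  next
    have "c0_apply (bump 0 1 :: 'k c0) 0 \<noteq> 0" by (simp add: bump_apply hat_def)
    then show "\<exists>v::'k c0. v \<noteq> 0" by (metis c0_apply_simps(1))
  qed
qed

text \<open>
  A bump of norm at most \<open>1\<close> centred at \<open>n + a\<close> is mapped to a function with the value \<open>w ^ n\<close>
  at \<open>n\<close>.
\<close>

lemma unbounded_translation:
  assumes "w > 1" "a > 0"
  shows "\<not> bounded_operator (translation w a :: 'k::{real_normed_field,banach} c0 operator)"
proof
  let ?T = "translation w a :: 'k c0 operator"
  assume "bounded_operator ?T"
  then obtain K where K: "\<And>x. x \<in> fst ?T \<Longrightarrow> norm (snd ?T x) \<le> K * norm x"
    unfolding bounded_operator_def by blast
  obtain n where n: "\<bar>K\<bar> < w ^ n" using real_arch_pow[OF assms(1)] by blast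
  define x :: "'k c0" where "x = bump (real n + a) 1"
  have "c0_apply x t = 0" if "t \<ge> real n + a + 1" for t
    using that assms by (simp add: x_def bump_apply hat_def)
  then have x: "x \<in> fst ?T" by (rule translation_domain_if_vanishes)
  have "norm x \<le> 1"
    by (rule c0_norm_least) (simp add: x_def bump_apply hat_def)
  have "w ^ n = norm (c0_apply (snd ?T x) (real n))"
    using assms x by (simp add: translation_apply) (simp add: x_def bump_apply hat_def powr_realpow)
  also have "\<dots> \<le> K * norm x" using c0_norm_upper K[OF x] by (rule order_trans)
  also have "\<dots> \<le> \<bar>K\<bar> * 1" using \<open>norm x \<le> 1\<close> by (intro mult_mono) auto
  finally show False using n by simp
qed

text \<open>
  A solution of \<open>T x = l x\<close> is the series of \<open>l ^ k\<close> times \<open>(S ^^ k) u\<close> with \<open>T u = 0\<close>,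
  because \<open>T\<close> kills the first term and turns every other term into \<open>l\<close> times its predecessor.
  Choosing \<open>u\<close> as a bump supported in \<open>[0, a]\<close> with \<open>u 0 = 0\<close> makes all terms but the first
  vanish on \<open>[0, a]\<close>, so that the solution agrees with \<open>u\<close> there and is not \<open>0\<close>.
\<close>

lemma eigenvector_translation:
  fixes l :: "'k::{real_normed_field,banach}"
  assumes "w > 1" "a > 0"
  shows "\<exists>x\<in>fst (translation w a). x \<noteq> 0 \<and> snd (translation w a) x = scale_c0 l x"
proof -
  let ?T = "translation w a :: 'k c0 operator" and ?S = "ramp_inverse w a :: 'k c0 \<Rightarrow> 'k c0"
  interpret summably_right_invertible ?T ?S
    by (rule right_invertible_translation[OF assms])
  have wa: "w > 0" "a \<ge> 0" using assms by auto
  define u :: "'k c0" where "u = bump (a / 2) (2 / a)"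
  have u_support: "c0_apply u t = 0" if "t \<ge> a" for t
    using that assms by (simp add: u_def bump_apply hat_def field_simps)
  have u_0: "c0_apply u 0 = 0" and u_mid: "c0_apply u (a / 2) = 1"
    using assms by (auto simp: u_def bump_apply hat_def)
  have u: "u \<in> fst ?T" "snd ?T u = 0"
    using translation_domainI[OF wa, of 0 u] u_support by auto
  define f where "f k = scale_c0 (l ^ k) ((?S ^^ k) u)" for k
  have f: "summable f"
    using summable_ramp_inverse_powers[OF assms, of "norm l" u] summable_norm_cancel[of f]
    by (simp add: f_def norm_scale_c0 norm_power)
  have f0: "f 0 = u" by (rule c0_eqI) (simp add: f_def)
  have T0: "f 0 \<in> fst ?T" "snd ?T (f 0) = 0" using u by (simp_all add: f0)
  have TSuc: "f (Suc k) \<in> fst ?T" "snd ?T (f (Suc k)) = scale_c0 l (f k)" for k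
  proof -
    have "scale_c0 (l ^ Suc k) x = scale_c0 l (scale_c0 (l ^ k) x)" for x
      by (rule c0_eqI) (simp add: mult.assoc)
    then show "f (Suc k) \<in> fst ?T" "snd ?T (f (Suc k)) = scale_c0 l (f k)"
      using translation_scale_c0[OF wa S_domain, of "l ^ Suc k" "(?S ^^ k) u"]
      by (simp_all add: f_def T_S del: power.simps)
  qed
  have dom: "f k \<in> fst ?T" for k using T0 TSuc by (cases k) auto
  have lf: "summable (\<lambda>k. scale_c0 l (f k))"
    by (rule bounded_linear.summable[OF bounded_linear_scale_c0 f])
  have Tf: "summable (\<lambda>k. snd ?T (f k))"
    using lf summable_Suc_iff[of "\<lambda>k. snd ?T (f k)"] by (simp add: TSuc)
  have x: "suminf f \<in> fst ?T" by (rule suminf_domain[OF dom f Tf])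
  have "snd ?T (suminf f) = (\<Sum>k. snd ?T (f k))" by (rule suminf_domain[OF dom f Tf])
  also have "(\<Sum>k. snd ?T (f k)) = (\<Sum>k. scale_c0 l (f k))"
    using suminf_split_head[OF Tf] by (simp add: TSuc T0)
  also have "\<dots> = scale_c0 l (suminf f)"
    by (rule bounded_linear.suminf[OF bounded_linear_scale_c0 f, symmetric])
  finally have eig: "snd ?T (suminf f) = scale_c0 l (suminf f)" .
  have "c0_apply (f (Suc k)) (a / 2) = 0" for k
  proof -
    have "c0_apply ((?S ^^ k) u) 0 = 0"
      using u_0 assms by (cases k) (auto simp: ramp_inverse_apply)
    then have "c0_apply (?S ((?S ^^ k) u)) (a / 2) = 0"
      using assms by (simp add: ramp_inverse_apply)
    then show ?thesis by (simp add: f_def)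
  qed
  then have tail: "c0_apply (f k) (a / 2) = 0" if "k \<noteq> 0" for k
    using that by (cases k) auto
  have "c0_apply (suminf f) (a / 2) = (\<Sum>k. c0_apply (f k) (a / 2))"
    by (rule bounded_linear.suminf[OF bounded_linear_c0_apply f])
  also have "\<dots> = c0_apply (f 0) (a / 2)"
    using suminf_finite[of "{0}" "\<lambda>k. c0_apply (f k) (a / 2)"] tail by simp
  finally have "c0_apply (suminf f) (a / 2) = 1" by (simp add: f0 u_mid)
  then have "suminf f \<noteq> 0" by auto
  with x eig show ?thesis by blast
qed

lemma point_spectrum_subset_spectrum: "point_spectrum scl T \<subseteq> spectrum scl T"
proof
  fix l assume "l \<in> point_spectrum scl T"
  then have "\<not> inj_on (\<lambda>x. snd T x - scl l x) (fst T)"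
    by (simp add: point_spectrum_def)
  moreover have "inj_on (\<lambda>x. snd T x - scl l x) (fst T)" if "l \<in> resolvent_set scl T"
    using that unfolding resolvent_set_def by (auto intro: inj_on_inverseI)
  ultimately show "l \<in> spectrum scl T" by (auto simp: spectrum_def)
qed

lemma point_spectrum_translation:
  assumes "w > 1" "a > 0"
  shows "point_spectrum scale_c0 (translation w a :: 'k::{real_normed_field,banach} c0 operator) = UNIV"
proof -
  let ?T = "translation w a :: 'k c0 operator"
  have "l \<in> point_spectrum scale_c0 ?T" for l
  proof -
    obtain x where x: "x \<in> fst ?T" "x \<noteq> 0" "snd ?T x = scale_c0 l x"
      using eigenvector_translation[OF assms, of l] by blast
    have "scale_c0 l 0 = 0" by (rule c0_eqI) simp
    moreover have "snd ?T 0 = 0"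
      using translation_domainI(2)[of w a 0 0] assms by simp
    ultimately have "snd ?T 0 - scale_c0 l 0 = snd ?T x - scale_c0 l x"
      using x(3) by simp
    then show ?thesis
      using x(1,2) zero_translation_domain unfolding point_spectrum_def inj_on_def by blast
  qed
  then show ?thesis by blast
qed

theorem theorem6p1:
  fixes w a :: real
  assumes "w > 1" and "a > 0"
  shows "(linear_operator scale_c0 (translation w a :: real c0 operator) \<and>
          \<not> bounded_operator (translation w a :: real c0 operator) \<and>
          chaotic (translation w a :: real c0 operator)) \<and>
         (linear_operator scale_c0 (translation w a :: complex c0 operator) \<and>
          \<not> bounded_operator (translation w a :: complex c0 operator) \<and>
          chaotic (translation w a :: complex c0 operator)) \<and>
         spectrum scale_c0 (translation w a :: complex c0 operator)
           = point_spectrum scale_c0 (translation w a :: complex c0 operator) \<and>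
         point_spectrum scale_c0 (translation w a :: complex c0 operator) = UNIV"
proof -
  note wa = assms less_trans[OF zero_less_one assms(1)] less_imp_le[OF assms(2)]
  have "point_spectrum scale_c0 (translation w a :: complex c0 operator) = UNIV"
    by (rule point_spectrum_translation[OF assms])
  moreover have "spectrum scale_c0 (translation w a :: complex c0 operator) = UNIV"
    using point_spectrum_subset_spectrum[of scale_c0 "translation w a :: complex c0 operator"]
      point_spectrum_translation[OF assms] by blast
  ultimately show ?thesis
    by (intro conjI linear_operator_translation unbounded_translation chaotic_translation wa) simp_all
qed

end
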